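(* Let $\mathcal{M}'''_m$ be a meridian surface of parabolic type from the general class, with generating functions $f(u), g(u), \varphi(v)$. Let $a\neq 0$ be a constant. Then $\mathcal{M}'''_m$ has constant mean curvature $\|H\|=a$ if and only if $\kappa(v)$ is a constant $b\neq0$ and the meridian $m$ is determined by $f'=y(f)$, where $$y(t)=\frac1t\left(C\pm\frac t2\sqrt{b^2-4a^2t^2}\pm\frac{b^2}{4a}\arcsin\frac{2at}{b}\right),\quad C=\text{const},\qquad\text{if }\langle H,H\rangle>0,$$ $$y(t)=\frac1t\left(C\pm\frac t2\sqrt{b^2+4a^2t^2}\pm\frac{b^2}{4a}\ln\left|2at+\sqrt{b^2+4a^2t^2}\right|\right),\quad C=\text{const},\qquad\text{if }\langle H,H\rangle<0,$$ and $g(u)$ is defined by $g'(u)=-\dfrac{1}{2f'(u)}$.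
   Context: $\mathbb{R}^4_1$ is the four-dimensional Minkowski space with metric $\langle\cdot,\cdot\rangle$ of signature $(3,1)$ and standard orthonormal frame $\{e_1,e_2,e_3,e_4\}$, $\langle e_1,e_1\rangle=\langle e_2,e_2\rangle=\langle e_3,e_3\rangle=1$, $\langle e_4,e_4\rangle=-1$. Put $\xi_1=\frac{e_3+e_4}{\sqrt2}$, $\xi_2=\frac{-e_3+e_4}{\sqrt2}$, so $\langle\xi_1,\xi_1\rangle=\langle\xi_2,\xi_2\rangle=0$, $\langle\xi_1,\xi_2\rangle=-1$. A meridian surface of parabolic type $\mathcal{M}'''_m$ is the spacelike surface $$z(u,v) = f(u)\,\varphi(v)\cos v\, e_1 + f(u)\,\varphi(v)\sin v\, e_2+ \left(f(u)\frac{\varphi(v)^2}{2}+g(u)\right)\xi_1 + f(u)\,\xi_2,\quad u\in I,\ v\in J,$$ where $I,J\subset\mathbb{R}$ are intervals, $f,g:I\to\mathbb{R}$ and $\varphi:J\to\mathbb{R}$ are smooth, $f>0$, $-f'g'>0$ on $I$, and $\dot\varphi^2+\varphi^2>0$ on $J$ ($'=d/du$, dot $=d/dv$). The $u$-lines are congruent curves, called the meridians $m$, determined by $f,g$; they are assumed parameterized by arc length, i.e. $-2f'g'=1$. Their curvature is $\kappa_m(u)=\frac{f''(u)}{f'(u)}$. Put $$\kappa(v)=\frac{\varphi\ddot\varphi-2\dot\varphi^2-\varphi^2}{(\dot\varphi^2+\varphi^2)^{3/2}}.$$ The surface is from the general class if $\kappa_m(u)\,\kappa(v)\neq0$ for all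 $u\in I$, $v\in J$. The mean curvature vector field is $H=\frac12\operatorname{tr}\sigma$, where $\sigma$ is the second fundamental tensor of the surface in $\mathbb{R}^4_1$. It is a standing assumption that $\langle H,H\rangle\neq0$ everywhere; put $\varepsilon=\operatorname{sign}\langle H,H\rangle$. The mean curvature is $\|H\|=\sqrt{\varepsilon\langle H,H\rangle}$. The condition "the meridian is determined by $f'=y(f)$" means $f'(u)=y(f(u))$ for all $u\in I$.
   Formalization: The condition ‖H‖=a is read as ‖H‖=|a| (for a<0 the "if" part fails), and the two ± signs are linked: the second equals the first times sgn b in the arcsin case, and equals the first in the ln case; with other sign choices the "if" part is false. *)

theory Defs
  imports "HOL-Analysis.Analysis"
begin

text \<open>Minkowski space of signature (3,1), carried by \<^typ>\<open>real ^ 4\<close>.\<close>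

definition mink :: "real ^ 4 \<Rightarrow> real ^ 4 \<Rightarrow> real" where
  "mink x y = x $ 1 * y $ 1 + x $ 2 * y $ 2 + x $ 3 * y $ 3 - x $ 4 * y $ 4"

definition e :: "4 \<Rightarrow> real ^ 4" where
  "e i = axis i 1"

definition \<xi>1 :: "real ^ 4" where
  "\<xi>1 = (1 / sqrt 2) *\<^sub>R (e 3 + e 4)"

definition \<xi>2 :: "real ^ 4" where
  "\<xi>2 = (1 / sqrt 2) *\<^sub>R (- e 3 + e 4)"

text \<open>
  Smoothness on a set that need not be open (an interval may contain endpoints): the function is
  infinitely differentiable on an open neighbourhood.  For open \<open>S\<close> this is the usual notion;
  at an endpoint of a nondegenerate interval, derivatives of all orders are then determined by
  the restriction to the interval.
\<close>

definition smooth_on :: "(real \<Rightarrow> real) \<Rightarrow> real set \<Rightarrow> bool" where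
  "smooth_on f S \<longleftrightarrow>
     (\<exists>U. open U \<and> S \<subseteq> U \<and> (\<forall>n. ((deriv ^^ n) f) differentiable_on U))"

definition nondegenerate_interval :: "real set \<Rightarrow> bool" where
  "nondegenerate_interval I \<longleftrightarrow> is_interval I \<and> interior I \<noteq> {}"


section \<open>Parametrized surfaces in Minkowski space\<close>

type_synonym surface = "real \<Rightarrow> real \<Rightarrow> real ^ 4"

definition pu :: "surface \<Rightarrow> surface" where
  "pu z u v = vector_derivative (\<lambda>s. z s v) (at u)"

definition pv :: "surface \<Rightarrow> surface" where
  "pv z u v = vector_derivative (\<lambda>t. z u t) (at v)"

text \<open>
  The component of \<open>w\<close> normal to the plane spanned by \<open>x\<close> and \<open>y\<close>; it exists and is unique
  whenever \<^const>\<open>mink\<close> restricted to that plane is nondegenerate.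
\<close>

definition normal_part :: "real ^ 4 \<Rightarrow> real ^ 4 \<Rightarrow> real ^ 4 \<Rightarrow> real ^ 4" where
  "normal_part x y w = (THE n. w - n \<in> span {x, y} \<and> mink n x = 0 \<and> mink n y = 0)"

text \<open>
  Since the ambient connection is flat, \<open>\<sigma>\<close> on a pair of coordinate fields is the normal part
  of the corresponding second partial derivative of \<open>z\<close>.  The trace is taken with respect to the
  first fundamental form, i.e. with the inverse of the matrix \<open>((E, F), (F, G))\<close>.
\<close>

definition mean_curvature_vector :: "surface \<Rightarrow> surface" where
  "mean_curvature_vector z u v =
    (let zu = pu z u v; zv = pv z u v;
         E = mink zu zu; F = mink zu zv; G = mink zv zv;
         \<sigma>uu = normal_part zu zv (pu (pu z) u v);
         \<sigma>uv = normal_part zu zv (pu (pv z) u v);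
         \<sigma>vv = normal_part zu zv (pv (pv z) u v)
     in (1 / 2) *\<^sub>R ((1 / (E * G - F\<^sup>2)) *\<^sub>R
          (G *\<^sub>R \<sigma>uu - (2 * F) *\<^sub>R \<sigma>uv + E *\<^sub>R \<sigma>vv)))"

definition HH :: "surface \<Rightarrow> real \<Rightarrow> real \<Rightarrow> real" where
  "HH z u v = mink (mean_curvature_vector z u v) (mean_curvature_vector z u v)"

definition mean_curvature :: "surface \<Rightarrow> real \<Rightarrow> real \<Rightarrow> real" where
  "mean_curvature z u v = sqrt (sgn (HH z u v) * HH z u v)"


section \<open>Meridian surfaces of parabolic type\<close>

definition meridian_surface ::
  "(real \<Rightarrow> real) \<Rightarrow> (real \<Rightarrow> real) \<Rightarrow> (real \<Rightarrow> real) \<Rightarrow> surface" where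
  "meridian_surface f g \<phi> u v =
     (f u * \<phi> v * cos v) *\<^sub>R e 1 + (f u * \<phi> v * sin v) *\<^sub>R e 2
     + (f u * ((\<phi> v)\<^sup>2 / 2) + g u) *\<^sub>R \<xi>1 + f u *\<^sub>R \<xi>2"

text \<open>The last condition says that the meridians are parametrized by arc length.\<close>

definition parabolic_meridian_data ::
  "real set \<Rightarrow> real set \<Rightarrow> (real \<Rightarrow> real) \<Rightarrow> (real \<Rightarrow> real) \<Rightarrow> (real \<Rightarrow> real) \<Rightarrow> bool" where
  "parabolic_meridian_data I J f g \<phi> \<longleftrightarrow>
     nondegenerate_interval I \<and> nondegenerate_interval J \<and>
     smooth_on f I \<and> smooth_on g I \<and> smooth_on \<phi> J \<and>
     (\<forall>u\<in>I. f u > 0 \<and> - deriv f u * deriv g u > 0) \<and>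
     (\<forall>v\<in>J. (deriv \<phi> v)\<^sup>2 + (\<phi> v)\<^sup>2 > 0) \<and>
     (\<forall>u\<in>I. - 2 * deriv f u * deriv g u = 1)"

definition meridian_curvature :: "(real \<Rightarrow> real) \<Rightarrow> real \<Rightarrow> real" where
  "meridian_curvature f u = deriv (deriv f) u / deriv f u"

definition kappa :: "(real \<Rightarrow> real) \<Rightarrow> real \<Rightarrow> real" where
  "kappa \<phi> v =
     (\<phi> v * deriv (deriv \<phi>) v - 2 * (deriv \<phi> v)\<^sup>2 - (\<phi> v)\<^sup>2)
       / ((deriv \<phi> v)\<^sup>2 + (\<phi> v)\<^sup>2) powr (3 / 2)"

definition general_class ::
  "real set \<Rightarrow> real set \<Rightarrow> (real \<Rightarrow> real) \<Rightarrow> (real \<Rightarrow> real) \<Rightarrow> bool" where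
  "general_class I J f \<phi> \<longleftrightarrow> (\<forall>u\<in>I. \<forall>v\<in>J. meridian_curvature f u * kappa \<phi> v \<noteq> 0)"

text \<open>
  The right-hand sides \<open>y\<close> of the meridian equation.  The two signs in the published formulas
  are not independent: \<open>t * y t - C\<close> has to be an antiderivative of \<open>s * sqrt (b\<^sup>2 - 4 a\<^sup>2 t\<^sup>2)\<close>,
  respectively \<open>s * sqrt (b\<^sup>2 + 4 a\<^sup>2 t\<^sup>2)\<close>, with \<open>s\<close> being 1 or -1.  In the first case this forces
  the sign of the arcsine term to be \<open>s * sgn b\<close>, since \<open>arcsin (2 a t / b)\<close> is odd in \<open>b\<close>.
\<close>

definition y_pos :: "real \<Rightarrow> real \<Rightarrow> real \<Rightarrow> real \<Rightarrow> real \<Rightarrow> real" where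
  "y_pos a b C s t =
     1 / t * (C + s * (t / 2 * sqrt (b\<^sup>2 - 4 * a\<^sup>2 * t\<^sup>2))
                + s * sgn b * (b\<^sup>2 / (4 * a) * arcsin (2 * a * t / b)))"

definition y_neg :: "real \<Rightarrow> real \<Rightarrow> real \<Rightarrow> real \<Rightarrow> real \<Rightarrow> real" where
  "y_neg a b C s t =
     1 / t * (C + s * (t / 2 * sqrt (b\<^sup>2 + 4 * a\<^sup>2 * t\<^sup>2))
                + s * (b\<^sup>2 / (4 * a) * ln \<bar>2 * a * t + sqrt (b\<^sup>2 + 4 * a\<^sup>2 * t\<^sup>2)\<bar>))"

text \<open>
  \<open>f' = y(f)\<close> along the meridian, including that \<open>f\<close> takes its values in the domain \<open>D\<close>
  of the formula \<open>y\<close> (in HOL \<open>y\<close> itself is total).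
\<close>

definition meridian_determined_by ::
  "real set \<Rightarrow> (real \<Rightarrow> real) \<Rightarrow> real set \<Rightarrow> (real \<Rightarrow> real) \<Rightarrow> bool" where
  "meridian_determined_by I f D y \<longleftrightarrow> (\<forall>u\<in>I. f u \<in> D \<and> deriv f u = y (f u))"

end

theory Submission
  imports Defs
begin

text \<open>
  With \<open>h = f \<kappa>\<^sub>m + f'\<close> one has \<open>\<langle>H, H\<rangle> = (\<kappa>\<^sup>2 - h\<^sup>2) / (4 f\<^sup>2)\<close>, so constancy of \<open>\<langle>H, H\<rangle>\<close>
  separates the variables: \<open>\<kappa>\<close> is a constant \<open>b\<close>, and \<open>h\<^sup>2 = q(f)\<close> for a quadratic polynomial \<open>q\<close>.
  Since \<open>f\<close> is strictly monotone, \<open>q(f)\<close> can vanish only at an endpoint of \<open>I\<close>, so \<open>h\<close> has a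
  constant sign \<open>s\<close> in the interior, and \<open>(f f')' = f' h = s f' sqrt (q(f))\<close> integrates to
  \<open>f f' = C + s Q(f)\<close> with \<open>Q' = sqrt q\<close>; endpoints are recovered by continuity.
\<close>

section \<open>Products and normal parts in a null frame\<close>

definition frame_comb :: "real \<Rightarrow> real \<Rightarrow> real \<Rightarrow> real \<Rightarrow> real ^ 4" where
  "frame_comb p q r s = p *\<^sub>R e 1 + q *\<^sub>R e 2 + r *\<^sub>R \<xi>1 + s *\<^sub>R \<xi>2"

text \<open>The vectors \<open>\<xi>1\<close> and \<open>\<xi>2\<close> are null with product -1, so
  their coordinates contribute only cross terms. All later inner products are evaluated by this rule
  instead of in standard coordinates.\<close>

lemma mink_frame_comb: "mink (frame_comb p q r s) (frame_comb p' q' r' s') = p * p' + q * q' - r * s' - s * r'"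
  by (simp add: mink_def frame_comb_def e_def \<xi>1_def \<xi>2_def axis_def algebra_simps)

lemma has_vector_derivative_frame_comb:
  assumes "(p has_real_derivative p') (at x)" "(q has_real_derivative q') (at x)"
    and "(r has_real_derivative r') (at x)" "(s has_real_derivative s') (at x)"
  shows "((\<lambda>x. frame_comb (p x) (q x) (r x) (s x)) has_vector_derivative frame_comb p' q' r' s') (at x)"
  unfolding frame_comb_def
  by (rule derivative_eq_intros assms refl)+ simp

lemma mink_diff_left: "mink (x - y) w = mink x w - mink y w"
  and mink_add_left: "mink (x + y) w = mink x w + mink y w"
  and mink_add_right: "mink w (x + y) = mink w x + mink w y"
  and mink_diff_right: "mink w (x - y) = mink w x - mink w y"
  and mink_scaleR_left: "mink (c *\<^sub>R x) w = c * mink x w"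
  and mink_scaleR_right: "mink w (c *\<^sub>R x) = c * mink w x"
  and mink_commute: "mink x w = mink w x"
  by (simp_all add: mink_def algebra_simps)

lemmas mink_simps = mink_diff_left mink_add_left mink_add_right mink_diff_right
  mink_scaleR_left mink_scaleR_right

text \<open>Subtracting the two orthogonal projections gives a candidate. It is the only one: if
  \<open>w - n = c x + d y\<close> with \<open>n\<close> normal, pairing with \<open>x\<close> and
  \<open>y\<close> determines \<open>c\<close> and \<open>d\<close>, because neither vector is null.
  This settles the definite description in \<open>normal_part\<close>.\<close>

lemma normal_part_orthogonal:
  assumes "mink x x \<noteq> 0" "mink y y \<noteq> 0" "mink x y = 0"
  shows "normal_part x y w = w - (mink w x / mink x x) *\<^sub>R x - (mink w y / mink y y) *\<^sub>R y"
  unfolding normal_part_def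
proof (rule the_equality)
  have yx: "mink y x = 0" using assms(3) mink_commute by metis
  have "(mink w x / mink x x) *\<^sub>R x + (mink w y / mink y y) *\<^sub>R y \<in> span {x, y}"
    by (intro span_add span_scale span_base) auto
  then show "w - (w - (mink w x / mink x x) *\<^sub>R x - (mink w y / mink y y) *\<^sub>R y) \<in> span {x, y} \<and>
     mink (w - (mink w x / mink x x) *\<^sub>R x - (mink w y / mink y y) *\<^sub>R y) x = 0 \<and>
     mink (w - (mink w x / mink x x) *\<^sub>R x - (mink w y / mink y y) *\<^sub>R y) y = 0"
    using assms yx by (simp add: mink_simps)
next
  fix n assume n: "w - n \<in> span {x, y} \<and> mink n x = 0 \<and> mink n y = 0"
  have yx: "mink y x = 0" using assms(3) mink_commute by metis
  from n obtain c d where "w - n = c *\<^sub>R x + d *\<^sub>R y"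
    by (auto simp: span_insert algebra_simps span_singleton)
  then have w: "w = n + c *\<^sub>R x + d *\<^sub>R y" by (simp add: algebra_simps)
  then show "n = w - (mink w x / mink x x) *\<^sub>R x - (mink w y / mink y y) *\<^sub>R y"
    using n assms yx by (simp add: mink_simps)
qed

text \<open>For E = 1 and F = 0 the mixed term of the trace drops out, so \<open>pu (pv z)\<close>
  never has to be computed. Moreover \<open>pu (pu z)\<close> is orthogonal to both tangent vectors,
  hence equal to its normal part; only \<open>pv (pv z)\<close> needs projecting. Expanding the
  square leaves inner products of partial derivatives.\<close>

lemma HH_orthogonal:
  assumes "mink (pu z u v) (pu z u v) = 1" and "mink (pu z u v) (pv z u v) = 0"
    and "mink (pv z u v) (pv z u v) = G" "G \<noteq> 0"
    and "mink (pu (pu z) u v) (pu z u v) = 0" "mink (pu (pu z) u v) (pv z u v) = 0"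
  shows "HH z u v = (mink (pv (pv z) u v) (pv (pv z) u v) - (mink (pv (pv z) u v) (pv z u v))\<^sup>2 / G
    - (mink (pv (pv z) u v) (pu z u v))\<^sup>2 + 2 * G * mink (pu (pu z) u v) (pv (pv z) u v)
    + G\<^sup>2 * mink (pu (pu z) u v) (pu (pu z) u v)) / (4 * G\<^sup>2)"
proof -
  define x y where "x = pu z u v" and "y = pv z u v"
  define xx yy where "xx = pu (pu z) u v" and "yy = pv (pv z) u v"
  have o: "mink x x = 1" "mink x y = 0" "mink y y = G" "mink xx x = 0" "mink xx y = 0"
    using assms by (simp_all add: x_def y_def xx_def)
  have c: "mink y x = 0" "mink x xx = 0" "mink y xx = 0" "mink x yy = mink yy x"
     "mink y yy = mink yy y" "mink yy xx = mink xx yy"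
    using o mink_commute by metis+
  have n1: "normal_part x y xx = xx"
    using o \<open>G \<noteq> 0\<close> by (simp add: normal_part_orthogonal)
  have n2: "normal_part x y yy = yy - mink yy x *\<^sub>R x - (mink yy y / G) *\<^sub>R y"
    using o \<open>G \<noteq> 0\<close> by (simp add: normal_part_orthogonal)
  have H: "mean_curvature_vector z u v = (1 / 2) *\<^sub>R ((1 / G) *\<^sub>R
     (G *\<^sub>R xx + (yy - mink yy x *\<^sub>R x - (mink yy y / G) *\<^sub>R y)))"
    unfolding mean_curvature_vector_def Let_def
    unfolding x_def[symmetric] y_def[symmetric] xx_def[symmetric] yy_def[symmetric]
    by (simp add: o n1 n2)
  have "HH z u v = (mink yy yy - (mink yy y)\<^sup>2 / G - (mink yy x)\<^sup>2 + 2 * G * mink xx yy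
    + G\<^sup>2 * mink xx xx) / (4 * G\<^sup>2)"
    unfolding HH_def H using \<open>G \<noteq> 0\<close>
    by (simp add: mink_simps o c field_simps power2_eq_square)
  then show ?thesis by (simp add: x_def y_def xx_def yy_def)
qed

section \<open>Smooth functions on intervals that may contain endpoints\<close>

lemma smooth_on_has_derivs:
  assumes "smooth_on f S"
  obtains U where "open U" "S \<subseteq> U"
    "\<forall>x\<in>U. (f has_real_derivative deriv f x) (at x)"
    "\<forall>x\<in>U. (deriv f has_real_derivative deriv (deriv f) x) (at x)"
proof -
  from assms obtain U where U: "open U" "S \<subseteq> U" "\<And>n. ((deriv ^^ n) f) differentiable_on U"
    unfolding smooth_on_def by blast
  have "((deriv ^^ n) f has_real_derivative deriv ((deriv ^^ n) f) x) (at x)" if "x \<in> U" for n x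
    using U that
    by (metis DERIV_deriv_iff_real_differentiable differentiable_on_eq_differentiable_at)
  from this[of _ 0] this[of _ 1] U that show thesis by simp
qed

lemma smooth_on_continuous:
  assumes "smooth_on f S"
  shows "continuous_on S f" "continuous_on S (deriv f)" "continuous_on S (deriv (deriv f))"
proof -
  have "continuous_on S ((deriv ^^ n) f)" for n
    using assms differentiable_imp_continuous_on continuous_on_subset unfolding smooth_on_def by blast
  from this[of 0] this[of 1] this[of 2]
  show "continuous_on S f" "continuous_on S (deriv f)" "continuous_on S (deriv (deriv f))"
    by (simp_all add: numeral_2_eq_2)
qed

text \<open>A nondegenerate interval lies in the closure of its interior. Identities known only on
  \<open>I\<close> can be differentiated at interior points alone; this lemma carries the result
  over to the endpoints.\<close>

lemma zero_on_interval_if_zero_on_interior: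
  fixes k :: "real \<Rightarrow> real"
  assumes "nondegenerate_interval I" "continuous_on I k" "\<And>x. x \<in> interior I \<Longrightarrow> k x = 0" "x \<in> I"
  shows "k x = 0"
proof -
  have "convex I" using assms(1) by (simp add: nondegenerate_interval_def is_interval_convex)
  then have "closure (interior I) = closure I"
    using assms(1) by (simp add: nondegenerate_interval_def convex_closure_interior)
  then obtain s where s: "\<And>n. s n \<in> interior I" "s \<longlonglongrightarrow> x"
    using assms(4) closure_subset by (metis closure_sequential subsetD)
  then have "(\<lambda>n. k (s n)) \<longlonglongrightarrow> k x"
    using assms(2,4) interior_subset unfolding continuous_on_sequentially o_def by blast
  moreover have "(\<lambda>n. k (s n)) = (\<lambda>n. 0)" using s assms(3) by auto
  ultimately show ?thesis by (simp add: LIMSEQ_const_iff)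
qed

lemma connected_nonzero_sign:
  fixes h :: "real \<Rightarrow> real"
  assumes "connected S" "continuous_on S h" "\<And>x. x \<in> S \<Longrightarrow> h x \<noteq> 0"
  shows "(\<forall>x\<in>S. h x > 0) \<or> (\<forall>x\<in>S. h x < 0)"
proof -
  have "connected (h ` S)" using assms connected_continuous_image by blast
  then have c: "0 \<in> h ` S" if "x \<in> S" "y \<in> S" "h x \<le> 0" "0 \<le> h y" for x y
    using that by (meson connectedD_interval imageI)
  show ?thesis
  proof (rule ccontr)
    assume "\<not> ?thesis"
    then obtain x y where "x \<in> S" "y \<in> S" "h x \<le> 0" "0 \<le> h y" by (auto simp: not_less)
    then show False using c assms(3) by fastforce
  qed
qed

section \<open>The squared mean curvature of a meridian surface\<close>

text \<open>The pure algebra behind \<open>HH_meridian_surface\<close>: \<open>F\<close>,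
  \<open>F1\<close>, \<open>F2\<close> stand for f and its derivatives, \<open>p\<close>,
  \<open>p1\<close>, \<open>p2\<close> for \<phi> and its derivatives, and the left side is the
  expression of \<open>HH_orthogonal\<close> with G = F^2 P.\<close>

lemma mean_curvature_components:
  fixes F F1 F2 p p1 p2 P :: real
  assumes "P = p1\<^sup>2 + p\<^sup>2" "P > 0" "F > 0" "F1 \<noteq> 0"
  shows "(F\<^sup>2 * ((p2 - p)\<^sup>2 + 4 * p1\<^sup>2) - (F\<^sup>2 * (p1 * (p2 + p)))\<^sup>2 / (F\<^sup>2 * P) - (F * F1 * P)\<^sup>2
     + 2 * (F\<^sup>2 * P) * (- (F * F2 * P)) + (F\<^sup>2 * P)\<^sup>2 * (- (F2 / F1)\<^sup>2)) / (4 * (F\<^sup>2 * P)\<^sup>2)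
    = (((p * p2 - 2 * p1\<^sup>2 - p\<^sup>2) / P powr (3 / 2))\<^sup>2 - (F * (F2 / F1) + F1)\<^sup>2) / (4 * F\<^sup>2)"
proof -
  have "(P powr (3 / 2))\<^sup>2 = P ^ 3"
    using assms(2) powr_realpow[of P 3] by (simp add: powr_power)
  then have R: "((p * p2 - 2 * p1\<^sup>2 - p\<^sup>2) / P powr (3 / 2))\<^sup>2 = (p * p2 - 2 * p1\<^sup>2 - p\<^sup>2)\<^sup>2 / P ^ 3"
    by (simp add: power_divide)
  \<comment> \<open>With A = p2 - p and B = 2 p1 this is the two-square identity (p1^2 + p^2)(A^2 +
    B^2) = (p A - p1 B)^2 + (p1 A + p B)^2; the first square is that of the numerator of
    \<open>kappa\<close>.\<close>
  have "P * ((p2 - p)\<^sup>2 + 4 * p1\<^sup>2) - (p1 * (p2 + p))\<^sup>2 = (p * p2 - 2 * p1\<^sup>2 - p\<^sup>2)\<^sup>2"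
    unfolding assms(1) by algebra
  then have Q: "(p2 - p)\<^sup>2 + 4 * p1\<^sup>2 = ((p * p2 - 2 * p1\<^sup>2 - p\<^sup>2)\<^sup>2 + (p1 * (p2 + p))\<^sup>2) / P"
    using assms(2) by (simp add: field_simps)
  define N m k where "N = p * p2 - 2 * p1\<^sup>2 - p\<^sup>2" and "m = p1 * (p2 + p)" and "k = F2 / F1"
  have F: "F \<noteq> 0" "P \<noteq> 0" using assms by auto
  have F2: "F2 = k * F1" using assms(4) by (simp add: k_def)
  have "F\<^sup>2 * ((N\<^sup>2 + m\<^sup>2) / P) - (F\<^sup>2 * m)\<^sup>2 / (F\<^sup>2 * P) = F\<^sup>2 * N\<^sup>2 / P"
    using F by (simp add: field_simps power2_eq_square)
  \<comment> \<open>Since F2 = k F1, the last three summands are -F^2 P^2 times F1^2 + 2 F k F1 +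
    F^2 k^2, a perfect square.\<close>
  then have "F\<^sup>2 * ((N\<^sup>2 + m\<^sup>2) / P) - (F\<^sup>2 * m)\<^sup>2 / (F\<^sup>2 * P) - (F * F1 * P)\<^sup>2
     + 2 * (F\<^sup>2 * P) * (- (F * F2 * P)) + (F\<^sup>2 * P)\<^sup>2 * (- k\<^sup>2)
    = F\<^sup>2 * N\<^sup>2 / P - F\<^sup>2 * P\<^sup>2 * (F * k + F1)\<^sup>2"
    unfolding F2 by algebra
  also have "\<dots> / (4 * (F\<^sup>2 * P)\<^sup>2) = (N\<^sup>2 / P ^ 3 - (F * k + F1)\<^sup>2) / (4 * F\<^sup>2)"
    using F by (simp add: field_simps power2_eq_square power3_eq_cube)
  finally show ?thesis unfolding R Q unfolding N_def m_def k_def .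
qed

text \<open>Arc length makes E = 1, and its derivative makes the second u-derivative of the surface
  orthogonal to the u-tangent. The net is orthogonal with G = f^2 (\<phi>'^2 + \<phi>^2), so
  \<open>HH_orthogonal\<close> applies and the rest is algebra.\<close>

lemma HH_meridian_surface:
  assumes "parabolic_meridian_data I J f g \<phi>" "u \<in> I" "v \<in> J"
  shows "HH (meridian_surface f g \<phi>) u v =
    ((kappa \<phi> v)\<^sup>2 - (f u * meridian_curvature f u + deriv f u)\<^sup>2) / (4 * (f u)\<^sup>2)"
proof -
  have sm: "smooth_on f I" "smooth_on g I" "smooth_on \<phi> J"
    and I: "nondegenerate_interval I"
    and fg: "\<And>u. u \<in> I \<Longrightarrow> - 2 * deriv f u * deriv g u = 1"
    and fpos: "f u > 0" and P: "(deriv \<phi> v)\<^sup>2 + (\<phi> v)\<^sup>2 > 0"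
    using assms by (auto simp: parabolic_meridian_data_def)
  obtain U where U: "open U" "I \<subseteq> U"
    "\<forall>x\<in>U. (f has_real_derivative deriv f x) (at x)"
    "\<forall>x\<in>U. (deriv f has_real_derivative deriv (deriv f) x) (at x)"
    using smooth_on_has_derivs[OF sm(1)] .
  obtain U' where U': "open U'" "I \<subseteq> U'"
    "\<forall>x\<in>U'. (g has_real_derivative deriv g x) (at x)"
    "\<forall>x\<in>U'. (deriv g has_real_derivative deriv (deriv g) x) (at x)"
    using smooth_on_has_derivs[OF sm(2)] .
  obtain V where V: "open V" "J \<subseteq> V"
    "\<forall>x\<in>V. (\<phi> has_real_derivative deriv \<phi> x) (at x)"
    "\<forall>x\<in>V. (deriv \<phi> has_real_derivative deriv (deriv \<phi>) x) (at x)"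
    using smooth_on_has_derivs[OF sm(3)] .
  note cf = smooth_on_continuous[OF sm(1)] and cg = smooth_on_continuous[OF sm(2)]
  have uU: "u \<in> U" "u \<in> U'" "v \<in> V" using U U' V assms by auto
  define z where "z = meridian_surface f g \<phi>"
  have z: "z = (\<lambda>s t. frame_comb (f s * \<phi> t * cos t) (f s * \<phi> t * sin t) (f s * ((\<phi> t)\<^sup>2 / 2) + g s) (f s))"
    by (simp add: z_def meridian_surface_def frame_comb_def fun_eq_iff)
  \<comment> \<open>First partials are needed on whole open neighbourhoods, not just on
    \<open>I\<close> and \<open>J\<close>, because they are differentiated once more, possibly at an
    endpoint.\<close>
  have zu: "pu z s t = frame_comb (deriv f s * \<phi> t * cos t) (deriv f s * \<phi> t * sin t)
      (deriv f s * ((\<phi> t)\<^sup>2 / 2) + deriv g s) (deriv f s)" if "s \<in> U \<inter> U'" for s t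
    unfolding pu_def z
  proof (intro vector_derivative_at has_vector_derivative_frame_comb)
    have F: "(f has_real_derivative deriv f s) (at s)" "(g has_real_derivative deriv g s) (at s)"
      using that U(3) U'(3) by auto
    show "((\<lambda>s. f s * \<phi> t * cos t) has_real_derivative deriv f s * \<phi> t * cos t) (at s)"
      "((\<lambda>s. f s * \<phi> t * sin t) has_real_derivative deriv f s * \<phi> t * sin t) (at s)"
      by (intro DERIV_cmult_right F)+
    show "((\<lambda>s. f s * ((\<phi> t)\<^sup>2 / 2) + g s) has_real_derivative
      deriv f s * ((\<phi> t)\<^sup>2 / 2) + deriv g s) (at s)"
      by (intro DERIV_add DERIV_cmult_right F)
  qed (use that U(3) in auto)
  have zv: "pv z s t = frame_comb (f s * (deriv \<phi> t * cos t - \<phi> t * sin t))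
      (f s * (deriv \<phi> t * sin t + \<phi> t * cos t)) (f s * (\<phi> t * deriv \<phi> t)) 0" if "t \<in> V" for s t
    unfolding pv_def z
  proof (intro vector_derivative_at has_vector_derivative_frame_comb)
    note F = V(3)[rule_format, OF that]
    show "((\<lambda>t. f s * \<phi> t * cos t) has_real_derivative
        f s * (deriv \<phi> t * cos t - \<phi> t * sin t)) (at t)"
      "((\<lambda>t. f s * \<phi> t * sin t) has_real_derivative
        f s * (deriv \<phi> t * sin t + \<phi> t * cos t)) (at t)"
      "((\<lambda>t. f s * ((\<phi> t)\<^sup>2 / 2) + g s) has_real_derivative
        f s * (\<phi> t * deriv \<phi> t)) (at t)"
      by (rule F derivative_eq_intros refl | simp add: algebra_simps)+
  qed simp
  have zuu: "pu (pu z) u v = frame_comb (deriv (deriv f) u * \<phi> v * cos v) (deriv (deriv f) u * \<phi> v * sin v)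
      (deriv (deriv f) u * ((\<phi> v)\<^sup>2 / 2) + deriv (deriv g) u) (deriv (deriv f) u)"
  proof -
    have "((\<lambda>s. frame_comb (deriv f s * \<phi> v * cos v) (deriv f s * \<phi> v * sin v)
      (deriv f s * ((\<phi> v)\<^sup>2 / 2) + deriv g s) (deriv f s)) has_vector_derivative
      frame_comb (deriv (deriv f) u * \<phi> v * cos v) (deriv (deriv f) u * \<phi> v * sin v)
      (deriv (deriv f) u * ((\<phi> v)\<^sup>2 / 2) + deriv (deriv g) u) (deriv (deriv f) u)) (at u)"
      by (intro has_vector_derivative_frame_comb DERIV_add DERIV_cmult_right U(4)[rule_format] U'(4)[rule_format] uU)
    then have "((\<lambda>s. pu z s v) has_vector_derivative
      frame_comb (deriv (deriv f) u * \<phi> v * cos v) (deriv (deriv f) u * \<phi> v * sin v)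
      (deriv (deriv f) u * ((\<phi> v)\<^sup>2 / 2) + deriv (deriv g) u) (deriv (deriv f) u)) (at u)"
      by (rule has_vector_derivative_transform_within_open[of _ _ _ "U \<inter> U'"])
        (use U(1) U'(1) uU zu in auto)
    then show ?thesis unfolding pu_def[of "pu z"] by (rule vector_derivative_at)
  qed
  have zvv: "pv (pv z) u v = frame_comb
      (f u * (deriv (deriv \<phi>) v * cos v - 2 * (deriv \<phi> v * sin v) - \<phi> v * cos v))
      (f u * (deriv (deriv \<phi>) v * sin v + 2 * (deriv \<phi> v * cos v) - \<phi> v * sin v))
      (f u * ((deriv \<phi> v)\<^sup>2 + \<phi> v * deriv (deriv \<phi>) v)) 0" (is "_ = ?R")
  proof -
    have "((\<lambda>t. frame_comb (f u * (deriv \<phi> t * cos t - \<phi> t * sin t))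
      (f u * (deriv \<phi> t * sin t + \<phi> t * cos t)) (f u * (\<phi> t * deriv \<phi> t)) 0)
      has_vector_derivative ?R) (at v)"
      by (rule has_vector_derivative_frame_comb;
          (rule V(3,4)[rule_format, OF uU(3)] derivative_eq_intros refl
            | simp add: algebra_simps power2_eq_square)+)
    then have "((\<lambda>t. pv z u t) has_vector_derivative ?R) (at v)"
      by (rule has_vector_derivative_transform_within_open[of _ _ _ V])
        (use V(1) uU zv in auto)
    then show ?thesis unfolding pv_def[of "pv z"] by (rule vector_derivative_at)
  qed
  \<comment> \<open>The derivative of the constant f' g' = -1/2. Outside \<open>I\<close> the
    product need not be constant, so an endpoint is reached by continuity.\<close>
  have fg': "deriv (deriv f) u * deriv g u + deriv f u * deriv (deriv g) u = 0"
  proof (rule zero_on_interval_if_zero_on_interior[OF I _ _ assms(2)])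
    show "continuous_on I (\<lambda>u. deriv (deriv f) u * deriv g u + deriv f u * deriv (deriv g) u)"
      by (intro continuous_intros cf cg)
    fix x assume x: "x \<in> interior I"
    then have xI: "x \<in> I" using interior_subset by blast
    have "((\<lambda>x. deriv f x * deriv g x) has_real_derivative
      deriv (deriv f) x * deriv g x + deriv f x * deriv (deriv g) x) (at x)"
      using U(2,4) U'(2,4) xI by (auto intro!: derivative_eq_intros)
    moreover have "((\<lambda>x. deriv f x * deriv g x) has_real_derivative 0) (at x)"
    proof (rule has_field_derivative_transform_within_open[of "\<lambda>x. - 1 / 2" _ _ "interior I"])
      fix y assume "y \<in> interior I"
      then have "- 2 * deriv f y * deriv g y = 1" using fg interior_subset by blast
      then show "- 1 / 2 = deriv f y * deriv g y" by simp
    qed (use x in auto)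
    ultimately show "deriv (deriv f) x * deriv g x + deriv f x * deriv (deriv g) x = 0"
      by (rule DERIV_unique)
  qed
  have f1: "deriv f u \<noteq> 0" using fg[OF assms(2)] by auto
  \<comment> \<open>Both derivatives of \<open>g\<close> are eliminated in favour of those of
    \<open>f\<close>.\<close>
  have g1: "deriv g u = - 1 / (2 * deriv f u)"
    using fg[OF assms(2)] f1 by (simp add: field_simps)
  have g2: "deriv (deriv g) u = deriv (deriv f) u / (2 * (deriv f u)\<^sup>2)"
    using fg' f1 unfolding g1 by (simp add: field_simps power2_eq_square)
  \<comment> \<open>Cosine and sine become mere letters subject to \<open>cs\<close>, which turns
    the ten inner products below into polynomial identities.\<close>
  define c s where "c = cos v" and "s = sin v"
  have cs: "s\<^sup>2 + c\<^sup>2 = 1" by (simp add: c_def s_def)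
  define P where "P = (deriv \<phi> v)\<^sup>2 + (\<phi> v)\<^sup>2"
  note D = zu[of u v] zv[of v u] zuu zvv
  note D' = D[folded c_def s_def]
  have 1: "mink (pu z u v) (pu z u v) = 1"
    using uU f1 cs by (simp add: D' mink_frame_comb g1 field_simps power2_eq_square) algebra
  have 2: "mink (pu z u v) (pv z u v) = 0"
    using uU f1 cs by (simp add: D' mink_frame_comb) algebra
  have 3: "mink (pv z u v) (pv z u v) = (f u)\<^sup>2 * P"
    using uU cs by (simp add: D' mink_frame_comb P_def) algebra
  have 4: "mink (pu (pu z) u v) (pu z u v) = 0"
    using uU f1 cs by (simp add: D' mink_frame_comb g1 g2 field_simps power2_eq_square) algebra
  have 5: "mink (pu (pu z) u v) (pv z u v) = 0"
    using uU cs by (simp add: D' mink_frame_comb) algebra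
  have 6: "mink (pv (pv z) u v) (pv (pv z) u v) =
      (f u)\<^sup>2 * ((deriv (deriv \<phi>) v - \<phi> v)\<^sup>2 + 4 * (deriv \<phi> v)\<^sup>2)"
    using uU cs by (simp add: D' mink_frame_comb) algebra
  have 7: "mink (pv (pv z) u v) (pv z u v) = (f u)\<^sup>2 * (deriv \<phi> v * (deriv (deriv \<phi>) v + \<phi> v))"
    using uU cs by (simp add: D' mink_frame_comb) algebra
  have 8: "mink (pv (pv z) u v) (pu z u v) = - (f u * deriv f u * P)"
    using uU cs by (simp add: D' mink_frame_comb P_def) algebra
  have 9: "mink (pu (pu z) u v) (pv (pv z) u v) = - (f u * deriv (deriv f) u * P)"
    using uU cs by (simp add: D' mink_frame_comb P_def) algebra
  have 10: "mink (pu (pu z) u v) (pu (pu z) u v) = - (deriv (deriv f) u / deriv f u)\<^sup>2"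
    using uU f1 cs by (simp add: D' mink_frame_comb g2 field_simps power2_eq_square) algebra
  have Ppos: "P > 0" using P by (simp add: P_def)
  have G0: "(f u)\<^sup>2 * P \<noteq> 0" using Ppos fpos by simp
  show ?thesis
    unfolding z_def[symmetric] HH_orthogonal[OF 1 2 3 G0 4 5] 6 7 8 9 10 power2_minus
      kappa_def meridian_curvature_def P_def[symmetric]
    by (rule mean_curvature_components[OF P_def Ppos fpos f1])
qed

section \<open>The differential equation of the meridian\<close>

text \<open>Keeping \<open>q\<close> and its antiderivative \<open>Q\<close> abstract serves both
  causal types at once. Positivity of \<open>q\<close> and differentiability of \<open>Q\<close> are
  required only over the interior, since in the arcsine case the radicand may vanish at an endpoint
  of \<open>I\<close>; there continuity has to suffice.\<close>

lemma meridian_equation_iff: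
  fixes f q Q :: "real \<Rightarrow> real"
  assumes I: "nondegenerate_interval I" and "smooth_on f I"
    and nz: "\<And>u. u \<in> I \<Longrightarrow> f u > 0" "\<And>u. u \<in> I \<Longrightarrow> deriv f u \<noteq> 0"
    and cq: "continuous_on (f ` I) q" and cQ: "continuous_on (f ` I) Q"
    and qpos: "\<And>u. u \<in> interior I \<Longrightarrow> q (f u) > 0"
    and dQ: "\<And>u. u \<in> interior I \<Longrightarrow> (Q has_real_derivative sqrt (q (f u))) (at (f u))"
  shows "(\<forall>u\<in>I. (f u * meridian_curvature f u + deriv f u)\<^sup>2 = q (f u)) \<longleftrightarrow>
    (\<exists>C. \<exists>s\<in>{1, -1}. \<forall>u\<in>I. deriv f u = 1 / f u * (C + s * Q (f u)))"
proof -
  obtain U where U: "I \<subseteq> U"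
    "\<forall>x\<in>U. (f has_real_derivative deriv f x) (at x)"
    "\<forall>x\<in>U. (deriv f has_real_derivative deriv (deriv f) x) (at x)"
    using smooth_on_has_derivs[OF assms(2)] by metis
  note cf = smooth_on_continuous[OF assms(2)]
  define h where "h u = f u * meridian_curvature f u + deriv f u" for u
  have ch: "continuous_on I h"
    unfolding h_def meridian_curvature_def using nz by (intro continuous_intros cf) auto
  have cqf: "continuous_on I (\<lambda>u. q (f u))" and cQf: "continuous_on I (\<lambda>u. Q (f u))"
    using continuous_on_compose2[OF cq cf(1)] continuous_on_compose2[OF cQ cf(1)] by auto
  have int: "u \<in> I" if "u \<in> interior I" for u using that interior_subset by blast
  have convex: "convex (interior I)"
    using I by (simp add: nondegenerate_interval_def is_interval_convex convex_interior)
  \<comment> \<open>As f' \<kappa>_m = f'', the derivative of f f' is f' h. The factor f' never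
    vanishes, so constancy of this first integral is equivalent to h = s sqrt (q(f)).\<close>
  have deriv: "((\<lambda>u. f u * deriv f u - s * Q (f u)) has_real_derivative
      deriv f u * (h u - s * sqrt (q (f u)))) (at u)" if "u \<in> interior I" for s u
  proof -
    have "((\<lambda>u. Q (f u)) has_real_derivative sqrt (q (f u)) * deriv f u) (at u)"
      using DERIV_chain2[where f = Q and g = f, OF dQ[OF that]] U int[OF that] by blast
    then have "((\<lambda>u. f u * deriv f u - s * Q (f u)) has_real_derivative
      deriv f u * deriv f u + deriv (deriv f) u * f u - s * (sqrt (q (f u)) * deriv f u)) (at u)"
      using U int[OF that] by (auto intro!: derivative_eq_intros)
    moreover have "deriv f u * (h u - s * sqrt (q (f u))) =
      deriv f u * deriv f u + deriv (deriv f) u * f u - s * (sqrt (q (f u)) * deriv f u)"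
      using nz(2)[OF int[OF that]] by (simp add: h_def meridian_curvature_def field_simps)
    ultimately show ?thesis by simp
  qed
  have "(\<forall>u\<in>I. (h u)\<^sup>2 = q (f u)) \<longleftrightarrow>
    (\<exists>C. \<exists>s\<in>{1, -1}. \<forall>u\<in>I. deriv f u = 1 / f u * (C + s * Q (f u)))" (is "?L \<longleftrightarrow> ?R")
  proof
    assume L: ?L
    have hnz: "h u \<noteq> 0" if "u \<in> interior I" for u
      using L int[OF that] qpos[OF that] by fastforce
    have "(\<forall>u\<in>interior I. h u > 0) \<or> (\<forall>u\<in>interior I. h u < 0)"
      by (rule connected_nonzero_sign[OF convex_connected[OF convex] _ hnz])
        (use ch interior_subset continuous_on_subset in blast)+
    then obtain s :: real where s: "s \<in> {1, -1}" "\<And>u. u \<in> interior I \<Longrightarrow> h u = s * \<bar>h u\<bar>"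
    proof
      assume "\<forall>u\<in>interior I. h u > 0"
      then show thesis by (intro that[of 1]) auto
    next
      assume "\<forall>u\<in>interior I. h u < 0"
      then show thesis by (intro that[of "-1"]) auto
    qed
    have hs: "h u = s * sqrt (q (f u))" if "u \<in> interior I" for u
      using L s(2)[OF that] int[OF that] by (metis real_sqrt_abs)
    have "\<exists>C. \<forall>u\<in>interior I. f u * deriv f u - s * Q (f u) = C"
    proof (rule has_field_derivative_zero_constant[OF convex, THEN exE], rule has_field_derivative_at_within)
      fix u assume "u \<in> interior I"
      then show "((\<lambda>u. f u * deriv f u - s * Q (f u)) has_real_derivative 0) (at u)"
        using deriv[of u s] hs by simp
    qed blast
    then obtain C where C: "\<And>u. u \<in> interior I \<Longrightarrow> f u * deriv f u - s * Q (f u) = C" by blast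
    \<comment> \<open>The constant found in the interior also serves at the endpoints.\<close>
    have "f u * deriv f u - s * Q (f u) - C = 0" if "u \<in> I" for u
      by (rule zero_on_interval_if_zero_on_interior[OF I _ _ that])
        (use C in \<open>auto intro!: continuous_intros cf cQf\<close>)
    then have "deriv f u = 1 / f u * (C + s * Q (f u))" if "u \<in> I" for u
      using nz(1)[OF that] that by (fastforce simp: field_simps)
    then show ?R using s(1) by blast
  next
    assume ?R
    then obtain C s where s: "s \<in> {1, - 1 :: real}"
      and C: "\<And>u. u \<in> I \<Longrightarrow> deriv f u = 1 / f u * (C + s * Q (f u))" by blast
    have C': "f u * deriv f u - s * Q (f u) = C" if "u \<in> I" for u
      using C[OF that] nz(1)[OF that] by (simp add: field_simps)
    have "(h u)\<^sup>2 - q (f u) = 0" if "u \<in> I" for u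
    proof (rule zero_on_interval_if_zero_on_interior[OF I _ _ that])
      show "continuous_on I (\<lambda>u. (h u)\<^sup>2 - q (f u))" by (intro continuous_intros ch cqf)
      fix u assume u: "u \<in> interior I"
      \<comment> \<open>For the converse the first integral is constant on \<open>I\<close>;
        comparing its two derivatives in the interior yields h, and squaring removes s.\<close>
      have "((\<lambda>u. f u * deriv f u - s * Q (f u)) has_real_derivative 0) (at u)"
        by (rule has_field_derivative_transform_within_open[of "\<lambda>_. C" _ _ "interior I"])
          (use u C' int in auto)
      then have "deriv f u * (h u - s * sqrt (q (f u))) = 0"
        using deriv[OF u] DERIV_unique by blast
      then have "h u = s * sqrt (q (f u))" using nz(2) int u by auto
      then show "(h u)\<^sup>2 - q (f u) = 0"
        using s qpos[OF u] by (auto simp: power_mult_distrib)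
    qed
    then show ?L by simp
  qed
  then show ?thesis by (simp add: h_def)
qed

section \<open>The two explicit antiderivatives\<close>

text \<open>With r the square root, the product term contributes r/2 - 2 a^2 t^2 / r and the arcsine
  term b^2 / (2 r); since r^2 = b^2 - 4 a^2 t^2, they add up to r. The factor \<open>sgn b\<close>
  cancels the sign left over from |b| / b in the derivative of the arcsine.\<close>

lemma y_pos_antiderivative:
  fixes a b t :: real
  assumes "a \<noteq> 0" "b \<noteq> 0" "b\<^sup>2 - 4 * a\<^sup>2 * t\<^sup>2 > 0"
  shows "((\<lambda>t. t / 2 * sqrt (b\<^sup>2 - 4 * a\<^sup>2 * t\<^sup>2) + sgn b * (b\<^sup>2 / (4 * a) * arcsin (2 * a * t / b)))
    has_real_derivative sqrt (b\<^sup>2 - 4 * a\<^sup>2 * t\<^sup>2)) (at t)"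
proof -
  define r where "r = sqrt (b\<^sup>2 - 4 * a\<^sup>2 * t\<^sup>2)"
  have r: "r > 0" "r\<^sup>2 = b\<^sup>2 - 4 * a\<^sup>2 * t\<^sup>2" using assms by (auto simp: r_def)
  have "(2 * a * t / b)\<^sup>2 < 1" using assms by (simp add: power_divide power_mult_distrib)
  then have "\<bar>2 * a * t / b\<bar> < 1" by (simp only: abs_square_less_1)
  then have x: "- 1 < 2 * a * t / b" "2 * a * t / b < 1" by linarith+
  have "1 - (2 * a * t / b)\<^sup>2 = r\<^sup>2 / b\<^sup>2"
    using assms(2) by (simp add: r(2) power_divide power_mult_distrib field_simps)
  then have w: "sqrt (1 - (2 * a * t / b)\<^sup>2) = r / \<bar>b\<bar>"
    using r(1) by (simp add: real_sqrt_divide)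
  have A: "((\<lambda>t. sqrt (b\<^sup>2 - 4 * a\<^sup>2 * t\<^sup>2)) has_real_derivative - (4 * a\<^sup>2 * t / r)) (at t)"
  proof -
    have "((\<lambda>t. b\<^sup>2 - 4 * a\<^sup>2 * t\<^sup>2) has_real_derivative - (8 * a\<^sup>2 * t)) (at t)"
      by (auto intro!: derivative_eq_intros)
    from DERIV_chain2[OF DERIV_real_sqrt[OF assms(3)] this, folded r_def] show ?thesis
      using r(1) by (simp add: field_simps)
  qed
  have B: "((\<lambda>t. arcsin (2 * a * t / b)) has_real_derivative 2 * a / b * (\<bar>b\<bar> / r)) (at t)"
  proof -
    have "((\<lambda>t. 2 * a * t / b) has_real_derivative 2 * a / b) (at t)"
      using assms(2) by (auto intro!: derivative_eq_intros)
    from DERIV_chain2[where f = arcsin and g = "\<lambda>t. 2 * a * t / b", OF DERIV_arcsin[OF x] this] show ?thesis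
      unfolding w using assms(2) r(1) by (simp add: divide_simps mult.commute)
  qed
  have "((\<lambda>t. t / 2 * sqrt (b\<^sup>2 - 4 * a\<^sup>2 * t\<^sup>2) + sgn b * (b\<^sup>2 / (4 * a) * arcsin (2 * a * t / b)))
    has_real_derivative r / 2 - t / 2 * (4 * a\<^sup>2 * t / r)
      + sgn b * (b\<^sup>2 / (4 * a) * (2 * a / b * (\<bar>b\<bar> / r)))) (at t)"
    using DERIV_add[OF DERIV_mult[OF DERIV_cdivide[OF DERIV_ident, of 2] A]
        DERIV_cmult[OF DERIV_cmult[OF B, of "b\<^sup>2 / (4 * a)"], of "sgn b"]]
    by (simp add: r_def mult.commute)
  moreover have "sgn b * (b\<^sup>2 / (4 * a) * (2 * a / b * (\<bar>b\<bar> / r))) = b\<^sup>2 / (2 * r)"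
    using assms(1,2) r(1) by (cases "b > 0") (auto simp: field_simps power2_eq_square)
  moreover have "r / 2 - t / 2 * (4 * a\<^sup>2 * t / r) + b\<^sup>2 / (2 * r) = r"
    using r by (simp add: field_simps power2_eq_square)
  ultimately show ?thesis by (simp add: r_def)
qed

lemma y_neg_antiderivative:
  fixes a b t :: real
  assumes "a \<noteq> 0" "b \<noteq> 0"
  shows "((\<lambda>t. t / 2 * sqrt (b\<^sup>2 + 4 * a\<^sup>2 * t\<^sup>2)
      + b\<^sup>2 / (4 * a) * ln \<bar>2 * a * t + sqrt (b\<^sup>2 + 4 * a\<^sup>2 * t\<^sup>2)\<bar>)
    has_real_derivative sqrt (b\<^sup>2 + 4 * a\<^sup>2 * t\<^sup>2)) (at t)"
proof -
  have pos: "b\<^sup>2 + 4 * a\<^sup>2 * t\<^sup>2 > 0" for t using assms(2) by (simp add: add_pos_nonneg)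
  have lpos: "2 * a * t + sqrt (b\<^sup>2 + 4 * a\<^sup>2 * t\<^sup>2) > 0" for t
  proof -
    have "\<bar>2 * a * t\<bar> = sqrt (4 * a\<^sup>2 * t\<^sup>2)"
      by (simp add: real_sqrt_mult abs_mult)
    also have "\<dots> < sqrt (b\<^sup>2 + 4 * a\<^sup>2 * t\<^sup>2)" using assms(2) by simp
    finally show ?thesis by linarith
  qed
  define r where "r = sqrt (b\<^sup>2 + 4 * a\<^sup>2 * t\<^sup>2)"
  have r: "r > 0" "r\<^sup>2 = b\<^sup>2 + 4 * a\<^sup>2 * t\<^sup>2"
    using pos[of t] by (simp_all add: r_def)
  have l: "2 * a * t + r > 0" using lpos[of t] by (simp add: r_def)
  have d: "((\<lambda>t. sqrt (b\<^sup>2 + 4 * a\<^sup>2 * t\<^sup>2)) has_real_derivative (4 * a\<^sup>2 * t / r)) (at t)"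
  proof -
    have "((\<lambda>t. b\<^sup>2 + 4 * a\<^sup>2 * t\<^sup>2) has_real_derivative 8 * a\<^sup>2 * t) (at t)"
      by (auto intro!: derivative_eq_intros)
    from DERIV_chain2[OF DERIV_real_sqrt[OF pos] this, folded r_def] show ?thesis
      using r(1) by (simp add: field_simps)
  qed
  have B: "((\<lambda>t. ln (2 * a * t + sqrt (b\<^sup>2 + 4 * a\<^sup>2 * t\<^sup>2)))
      has_real_derivative (2 * a + 4 * a\<^sup>2 * t / r) / (2 * a * t + r)) (at t)"
  proof -
    have "((\<lambda>t. 2 * a * t + sqrt (b\<^sup>2 + 4 * a\<^sup>2 * t\<^sup>2)) has_real_derivative
      2 * a + 4 * a\<^sup>2 * t / r) (at t)"
      by (rule d derivative_eq_intros refl)+ simp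
    from DERIV_chain2[OF DERIV_ln_divide[OF lpos] this, folded r_def] show ?thesis
      by simp
  qed
  have B': "(2 * a + 4 * a\<^sup>2 * t / r) / (2 * a * t + r) = 2 * a / r"
    using l r(1) by (simp add: divide_simps) (simp add: algebra_simps power2_eq_square)
  have "((\<lambda>t. t / 2 * sqrt (b\<^sup>2 + 4 * a\<^sup>2 * t\<^sup>2)
      + b\<^sup>2 / (4 * a) * ln (2 * a * t + sqrt (b\<^sup>2 + 4 * a\<^sup>2 * t\<^sup>2)))
    has_real_derivative r / 2 + t / 2 * (4 * a\<^sup>2 * t / r) + b\<^sup>2 / (4 * a) * (2 * a / r)) (at t)"
    using DERIV_add[OF DERIV_mult[OF DERIV_cdivide[OF DERIV_ident, of 2] d]
        DERIV_cmult[OF B[unfolded B'], of "b\<^sup>2 / (4 * a)"]]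
    by (simp add: r_def mult.commute)
  moreover have "r / 2 + t / 2 * (4 * a\<^sup>2 * t / r) + b\<^sup>2 / (4 * a) * (2 * a / r) = r"
    using r assms(1) by (simp add: field_simps power2_eq_square)
  ultimately show ?thesis using lpos by (simp add: r_def abs_of_pos)
qed

section \<open>The meridian equation for the two causal types of H\<close>

lemma y_pos_iff:
  assumes I: "nondegenerate_interval I" and f: "smooth_on f I"
    and nz: "\<And>u. u \<in> I \<Longrightarrow> f u > 0" "\<And>u. u \<in> I \<Longrightarrow> deriv f u \<noteq> 0"
    and ab: "a \<noteq> 0" "b \<noteq> 0"
  shows "(\<forall>u\<in>I. (f u * meridian_curvature f u + deriv f u)\<^sup>2 = b\<^sup>2 - 4 * a\<^sup>2 * (f u)\<^sup>2) \<longleftrightarrow>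
    (\<exists>C. \<exists>s\<in>{1, -1}. meridian_determined_by I f {t. t \<noteq> 0 \<and> b\<^sup>2 - 4 * a\<^sup>2 * t\<^sup>2 \<ge> 0} (y_pos a b C s))"
    (is "?L \<longleftrightarrow> ?R")
\<comment> \<open>A negative radicand refutes both sides: on the left it would equal a square, on
  the right it is excluded by the domain.\<close>
proof (cases "\<forall>u\<in>I. b\<^sup>2 - 4 * a\<^sup>2 * (f u)\<^sup>2 \<ge> 0")
  case False
  then have "\<not> ?L" by (metis zero_le_power2)
  moreover have "\<not> ?R" using False by (auto simp: meridian_determined_by_def)
  ultimately show ?thesis by blast
next
  case ge: True
  define q where "q t = b\<^sup>2 - 4 * a\<^sup>2 * t\<^sup>2" for t
  define Q where "Q t = t / 2 * sqrt (q t) + sgn b * (b\<^sup>2 / (4 * a) * arcsin (2 * a * t / b))" for t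
  have cq: "continuous_on (f ` I) q" unfolding q_def by (intro continuous_intros)
  \<comment> \<open>The closed range [-1, 1] is enough for continuity of the arcsine, which covers a
    radicand vanishing at an endpoint.\<close>
  have "\<bar>2 * a * t / b\<bar> \<le> 1" if "t \<in> f ` I" for t
  proof -
    have "4 * a\<^sup>2 * t\<^sup>2 \<le> b\<^sup>2" using ge that by auto
    then have "(2 * a * t / b)\<^sup>2 \<le> 1" using ab(2) by (simp add: power_divide power_mult_distrib)
    then show ?thesis by (simp only: abs_square_le_1)
  qed
  then have "\<forall>t\<in>f ` I. - 1 \<le> 2 * a * t / b \<and> 2 * a * t / b \<le> 1"
    by (meson abs_le_iff minus_le_iff)
  then have cQ: "continuous_on (f ` I) Q"
    unfolding Q_def by (intro continuous_intros cq continuous_on_arcsin) (use ab in auto)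
  have qpos: "q (f u) > 0" if u: "u \<in> interior I" for u
  proof (rule ccontr)
    have int: "y \<in> I" if "y \<in> interior I" for y using that interior_subset by blast
    assume "\<not> q (f u) > 0"
    \<comment> \<open>The radicand is nonnegative along the meridian, so a zero at an interior point
      would be a local minimum; but its derivative there is -8 a^2 f f', which is nonzero.\<close>
    then have min: "q (f u) \<le> q (f y)" if "y \<in> interior I" for y
      using ge int[OF that] unfolding q_def by (metis not_less order_trans)
    have "(f has_real_derivative deriv f u) (at u)"
      using smooth_on_has_derivs[OF f] int[OF u] by (metis subsetD)
    then have d: "((\<lambda>u. q (f u)) has_real_derivative - (8 * a\<^sup>2 * f u * deriv f u)) (at u)"
      unfolding q_def by (auto intro!: derivative_eq_intros)
    obtain \<delta> where "\<delta> > 0" "ball u \<delta> \<subseteq> interior I"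
      using u open_contains_ball open_interior by blast
    then have "\<forall>y. \<bar>u - y\<bar> < \<delta> \<longrightarrow> q (f u) \<le> q (f y)"
      using min by (auto simp: ball_def dist_real_def)
    from DERIV_local_min[OF d \<open>\<delta> > 0\<close> this] show False
      using ab nz[OF int[OF u]] by simp
  qed
  have dQ: "(Q has_real_derivative sqrt (q (f u))) (at (f u))" if "u \<in> interior I" for u
    unfolding Q_def q_def using y_pos_antiderivative[OF ab] qpos[OF that] unfolding q_def .
  have y: "y_pos a b C s t = 1 / t * (C + s * Q t)" for C s t
    by (simp add: y_pos_def Q_def q_def algebra_simps)
  have D: "meridian_determined_by I f {t. t \<noteq> 0 \<and> b\<^sup>2 - 4 * a\<^sup>2 * t\<^sup>2 \<ge> 0} (y_pos a b C s) \<longleftrightarrow>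
      (\<forall>u\<in>I. deriv f u = 1 / f u * (C + s * Q (f u)))" for C s
    using ge nz(1) by (fastforce simp: meridian_determined_by_def y)
  show ?thesis
    unfolding D using meridian_equation_iff[OF I f nz cq cQ qpos dQ] by (simp add: q_def)
qed

text \<open>Here the radicand is at least b^2 > 0 for every t, so no domain or endpoint question
  arises.\<close>

lemma y_neg_iff:
  assumes I: "nondegenerate_interval I" and f: "smooth_on f I"
    and nz: "\<And>u. u \<in> I \<Longrightarrow> f u > 0" "\<And>u. u \<in> I \<Longrightarrow> deriv f u \<noteq> 0"
    and ab: "a \<noteq> 0" "b \<noteq> 0"
  shows "(\<forall>u\<in>I. (f u * meridian_curvature f u + deriv f u)\<^sup>2 = b\<^sup>2 + 4 * a\<^sup>2 * (f u)\<^sup>2) \<longleftrightarrow>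
    (\<exists>C. \<exists>s\<in>{1, -1}. meridian_determined_by I f {t. t \<noteq> 0} (y_neg a b C s))"
proof -
  define q where "q t = b\<^sup>2 + 4 * a\<^sup>2 * t\<^sup>2" for t
  define Q where "Q t = t / 2 * sqrt (q t)
      + b\<^sup>2 / (4 * a) * ln \<bar>2 * a * t + sqrt (q t)\<bar>" for t
  have cq: "continuous_on (f ` I) q" unfolding q_def by (intro continuous_intros)
  have dQ: "(Q has_real_derivative sqrt (q t)) (at t)" for t
    unfolding Q_def q_def by (rule y_neg_antiderivative[OF ab])
  then have cQ: "continuous_on (f ` I) Q"
    by (meson DERIV_continuous continuous_at_imp_continuous_on)
  have qpos: "q t > 0" for t unfolding q_def using ab(2) by (simp add: add_pos_nonneg)
  have y: "y_neg a b C s t = 1 / t * (C + s * Q t)" for C s t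
    by (simp add: y_neg_def Q_def q_def algebra_simps)
  have D: "meridian_determined_by I f {t. t \<noteq> 0} (y_neg a b C s) \<longleftrightarrow>
      (\<forall>u\<in>I. deriv f u = 1 / f u * (C + s * Q (f u)))" for C s
    using nz(1) by (fastforce simp: meridian_determined_by_def y)
  show ?thesis
    unfolding D using meridian_equation_iff[OF I f nz cq cQ qpos dQ] by (simp add: q_def)
qed

section \<open>Separation of variables and the characterization\<close>

theorem theorem4p1:
  fixes I J :: "real set" and f g \<phi> :: "real \<Rightarrow> real" and a :: real
  assumes "parabolic_meridian_data I J f g \<phi>"
    and "general_class I J f \<phi>"
    and "\<forall>u\<in>I. \<forall>v\<in>J. HH (meridian_surface f g \<phi>) u v \<noteq> 0"
    and "a \<noteq> 0"
  shows "(\<forall>u\<in>I. \<forall>v\<in>J. mean_curvature (meridian_surface f g \<phi>) u v = \<bar>a\<bar>) \<longleftrightarrow>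
    (\<exists>b. b \<noteq> 0 \<and> (\<forall>v\<in>J. kappa \<phi> v = b) \<and>
       ((\<forall>u\<in>I. \<forall>v\<in>J. HH (meridian_surface f g \<phi>) u v > 0) \<longrightarrow>
          (\<exists>C. \<exists>s\<in>{1, -1}. meridian_determined_by I f
             {t. t \<noteq> 0 \<and> b\<^sup>2 - 4 * a\<^sup>2 * t\<^sup>2 \<ge> 0} (y_pos a b C s))) \<and>
       ((\<forall>u\<in>I. \<forall>v\<in>J. HH (meridian_surface f g \<phi>) u v < 0) \<longrightarrow>
          (\<exists>C. \<exists>s\<in>{1, -1}. meridian_determined_by I f
             {t. t \<noteq> 0} (y_neg a b C s))) \<and>
       (\<forall>u\<in>I. deriv g u = - 1 / (2 * deriv f u)))"
proof -
  define z where "z = meridian_surface f g \<phi>"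
  define h where "h u = f u * meridian_curvature f u + deriv f u" for u
  have I: "nondegenerate_interval I" and J: "nondegenerate_interval J"
    and sm: "smooth_on f I" "smooth_on \<phi> J"
    and fg: "\<And>u. u \<in> I \<Longrightarrow> - 2 * deriv f u * deriv g u = 1"
    and fpos: "\<And>u. u \<in> I \<Longrightarrow> f u > 0"
    and P: "\<And>v. v \<in> J \<Longrightarrow> (deriv \<phi> v)\<^sup>2 + (\<phi> v)\<^sup>2 > 0"
    using assms(1) by (auto simp: parabolic_meridian_data_def)
  have f1: "deriv f u \<noteq> 0" if "u \<in> I" for u using fg[OF that] by auto
  have g1: "\<forall>u\<in>I. deriv g u = - 1 / (2 * deriv f u)"
    using fg f1 by (auto simp: field_simps)
  from I J obtain u0 v0 where u0: "u0 \<in> I" and v0: "v0 \<in> J"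
    using interior_subset unfolding nondegenerate_interval_def by blast
  have conn: "connected I" "connected J"
    using I J by (auto simp: nondegenerate_interval_def is_interval_connected)
  have HH: "HH z u v = ((kappa \<phi> v)\<^sup>2 - (h u)\<^sup>2) / (4 * (f u)\<^sup>2)" if "u \<in> I" "v \<in> J" for u v
    unfolding z_def h_def by (rule HH_meridian_surface[OF assms(1) that])
  have nz: "HH z u v \<noteq> 0" if "u \<in> I" "v \<in> J" for u v using assms(3) that by (auto simp: z_def)
  have ck: "continuous_on J (kappa \<phi>)"
    unfolding kappa_def using P by (intro continuous_intros smooth_on_continuous[OF sm(2)]) fastforce+
  have ch: "continuous_on I h"
    unfolding h_def meridian_curvature_def
    using f1 by (intro continuous_intros smooth_on_continuous[OF sm(1)]) auto
  have knz: "kappa \<phi> v \<noteq> 0" if "v \<in> J" for v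
    using assms(2) u0 that by (auto simp: general_class_def)
  have cu: "continuous_on I (\<lambda>u. HH z u v)" if "v \<in> J" for v
    by (subst continuous_on_cong[OF refl HH[OF _ that]])
      (use fpos in \<open>fastforce intro!: continuous_intros ch smooth_on_continuous[OF sm(1)]\<close>)+
  have cv: "continuous_on J (\<lambda>v. HH z u v)" if "u \<in> I" for u
    by (subst continuous_on_cong[OF refl HH[OF that]])
      (use fpos[OF that] in \<open>auto intro!: continuous_intros ck\<close>)
  have sign_u: "(\<forall>u\<in>I. HH z u v > 0) \<or> (\<forall>u\<in>I. HH z u v < 0)" if "v \<in> J" for v
    using connected_nonzero_sign[OF conn(1) cu[OF that]] nz that by blast
  have sign_v: "(\<forall>v\<in>J. HH z u0 v > 0) \<or> (\<forall>v\<in>J. HH z u0 v < 0)"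
    using connected_nonzero_sign[OF conn(2) cv[OF u0]] nz u0 by blast
  \<comment> \<open>The sign along the line u = u0 fixes the sign of every line v = const through
    it, so continuity in each variable separately suffices.\<close>
  have sign: "(\<forall>u\<in>I. \<forall>v\<in>J. HH z u v > 0) \<or> (\<forall>u\<in>I. \<forall>v\<in>J. HH z u v < 0)"
    using sign_u sign_v u0 v0 by (meson order_less_asym)
  \<comment> \<open>A constant square leaves only the sign of \<kappa> open, and that cannot change
    on the connected set \<open>J\<close>, where \<kappa> has no zero.\<close>
  have kconst: "\<forall>v\<in>J. kappa \<phi> v = kappa \<phi> v0" if "\<And>v. v \<in> J \<Longrightarrow> (kappa \<phi> v)\<^sup>2 = K" for K
  proof -
    have "(\<forall>v\<in>J. kappa \<phi> v > 0) \<or> (\<forall>v\<in>J. kappa \<phi> v < 0)"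
      using connected_nonzero_sign[OF conn(2) ck] knz by blast
    moreover have "kappa \<phi> v = kappa \<phi> v0 \<or> kappa \<phi> v = - kappa \<phi> v0" if "v \<in> J" for v
      using \<open>\<And>v. v \<in> J \<Longrightarrow> (kappa \<phi> v)\<^sup>2 = K\<close> that v0 by (metis power2_eq_iff)
    ultimately show ?thesis using v0 by (smt (verit))
  qed
  have mc: "mean_curvature z u v = \<bar>a\<bar> \<longleftrightarrow> \<bar>HH z u v\<bar> = a\<^sup>2" for u v
  proof -
    have "mean_curvature z u v = sqrt \<bar>HH z u v\<bar>"
      by (simp add: mean_curvature_def abs_sgn mult.commute)
    moreover have "\<bar>a\<bar> = sqrt (a\<^sup>2)" by simp
    ultimately show ?thesis by (metis real_sqrt_eq_iff)
  qed
  have eq: "HH z u v = c \<longleftrightarrow> (h u)\<^sup>2 = (kappa \<phi> v)\<^sup>2 - 4 * c * (f u)\<^sup>2" if "u \<in> I" "v \<in> J" for u v c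
    using fpos[OF that(1)] by (auto simp: HH[OF that] field_simps)
  \<comment> \<open>The value \<open>c\<close> is signed, to be used with a^2 and with -a^2. Fixing
    u = u0 shows that \<kappa>^2 does not depend on v; fixing v = v0 then leaves the equation for
    h.\<close>
  have const: "(\<forall>u\<in>I. \<forall>v\<in>J. HH z u v = c) \<longleftrightarrow>
      (\<exists>b. b \<noteq> 0 \<and> (\<forall>v\<in>J. kappa \<phi> v = b) \<and> (\<forall>u\<in>I. (h u)\<^sup>2 = b\<^sup>2 - 4 * c * (f u)\<^sup>2))" for c
  proof
    assume L: "\<forall>u\<in>I. \<forall>v\<in>J. HH z u v = c"
    have "(kappa \<phi> v)\<^sup>2 = (h u0)\<^sup>2 + 4 * c * (f u0)\<^sup>2" if "v \<in> J" for v
      using L u0 that eq[OF u0 that, of c] by simp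
    then have "\<forall>v\<in>J. kappa \<phi> v = kappa \<phi> v0" by (rule kconst)
    moreover have "\<forall>u\<in>I. (h u)\<^sup>2 = (kappa \<phi> v0)\<^sup>2 - 4 * c * (f u)\<^sup>2" using L eq v0 by blast
    ultimately show "\<exists>b. b \<noteq> 0 \<and> (\<forall>v\<in>J. kappa \<phi> v = b) \<and> (\<forall>u\<in>I. (h u)\<^sup>2 = b\<^sup>2 - 4 * c * (f u)\<^sup>2)"
      using knz[OF v0] by blast
  qed (use eq in auto)
  from sign show ?thesis
  proof
    assume pos: "\<forall>u\<in>I. \<forall>v\<in>J. HH z u v > 0"
    \<comment> \<open>This makes the implication for the opposite causal type vacuous; it needs the
      points \<open>u0\<close> and \<open>v0\<close>, as a universal statement over empty intervals
      would hold.\<close>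
    then have other: "\<not> (\<forall>u\<in>I. \<forall>v\<in>J. HH z u v < 0)" using u0 v0 by (meson order_less_asym)
    have mean: "(\<forall>u\<in>I. \<forall>v\<in>J. mean_curvature z u v = \<bar>a\<bar>) \<longleftrightarrow> (\<forall>u\<in>I. \<forall>v\<in>J. HH z u v = a\<^sup>2)"
      unfolding mc using pos by (metis abs_of_pos)
    have meridian: "(\<forall>u\<in>I. (h u)\<^sup>2 = b\<^sup>2 - 4 * a\<^sup>2 * (f u)\<^sup>2) \<longleftrightarrow>
      (\<exists>C. \<exists>s\<in>{1, -1}. meridian_determined_by I f {t. t \<noteq> 0 \<and> b\<^sup>2 - 4 * a\<^sup>2 * t\<^sup>2 \<ge> 0} (y_pos a b C s))"
      if "b \<noteq> 0" for b
      using y_pos_iff[OF I sm(1) fpos f1 assms(4) that] unfolding h_def by simp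
    show ?thesis
      unfolding z_def[symmetric] mean const
      by (intro ex_cong1 conj_cong refl) (use pos g1 other meridian in blast)
  next
    assume neg: "\<forall>u\<in>I. \<forall>v\<in>J. HH z u v < 0"
    then have other: "\<not> (\<forall>u\<in>I. \<forall>v\<in>J. HH z u v > 0)" using u0 v0 by (meson order_less_asym)
    have mean: "(\<forall>u\<in>I. \<forall>v\<in>J. mean_curvature z u v = \<bar>a\<bar>) \<longleftrightarrow> (\<forall>u\<in>I. \<forall>v\<in>J. HH z u v = - a\<^sup>2)"
      unfolding mc using neg by (metis abs_of_neg minus_equation_iff)
    \<comment> \<open>The value c = -a^2 turns the radicand into b^2 + 4 a^2 f^2, the one in
      \<open>y_neg\<close>.\<close>
    have meridian: "(\<forall>u\<in>I. (h u)\<^sup>2 = b\<^sup>2 - 4 * (- a\<^sup>2) * (f u)\<^sup>2) \<longleftrightarrow>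
      (\<exists>C. \<exists>s\<in>{1, -1}. meridian_determined_by I f {t. t \<noteq> 0} (y_neg a b C s))"
      if "b \<noteq> 0" for b
      using y_neg_iff[OF I sm(1) fpos f1 assms(4) that] unfolding h_def by simp
    show ?thesis
      unfolding z_def[symmetric] mean const
      by (intro ex_cong1 conj_cong refl) (use neg g1 other meridian in blast)
  qed
qed

end
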